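(* Let $q\ge 1$ be an integer and let $T$ be an infinite $(q+1)$-homogeneous tree rooted at $o$. For $1\le p\le\infty$, $\|\cdot\|_p$ induces a Banach space structure on $\mathbb{T}_p$; that is, $\|\cdot\|_p$ is a norm on the complex vector space $\mathbb{T}_p$ (with pointwise operations) and $(\mathbb{T}_p,\|\cdot\|_p)$ is complete.
   Context: A $(q+1)$-homogeneous tree is a connected graph without cycles in which every vertex has exactly $q+1$ neighbours; rooted means that a vertex $o$ (the root) is singled out. For a vertex $v$, $|v|$ is the number of edges in the unique path from $o$ to $v$; for $n\ge1$ there are $(q+1)q^{n-1}$ vertices with $|v|=n$. Functions on $T$ are functions on its vertices, and $v\in T$ means $v$ is a vertex. $\mathbb{N}=\{1,2,\dots\}$, $\mathbb{N}_0=\mathbb{N}\cup\{0\}$. For $f\colon T\to\mathbb{C}$ and $n\in\mathbb{N}$, $M_p(n,f)=\left(\frac{1}{(q+1)q^{n-1}}\sum_{|v|=n}|f(v)|^p\right)^{1/p}$ if $0<p<\infty$, $M_\infty(n,f)=\max_{|v|=n}|f(v)|$, and $M_p(0,f)=|f(o)|$ for all $p\in(0,\infty]$. Put $\|f\|_p=\sup_{n\in\mathbb{N}_0}M_p(n,f)$ and $\mathbb{T}_p=\{f\colon T\to\mathbb{C}:\|f\|_p<\infty\}$. *)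

theory Defs
  imports
    "HOL-Analysis.Analysis"
    "HOL-Library.Function_Algebras"
    "Graph_Theory.Digraph_Component"
begin

text \<open>
  An undirected simple graph is a loop-free symmetric digraph without parallel arcs
  (\<^locale>\<open>pair_bidirected_digraph\<close>), possibly infinite. Every edge then gives a directed
  2-cycle, so the absence of cycles refers to cycles of length at least 3; the library's
  \<^const>\<open>tree\<close> would forbid edges altogether.
\<close>

definition homogeneous_tree :: "nat \<Rightarrow> 'v pair_pre_digraph \<Rightarrow> bool" where
  "homogeneous_tree q G \<longleftrightarrow>
     pair_bidirected_digraph G \<and>
     Digraph_Component.connected (with_proj G) \<and>
     \<not> (\<exists>c. pre_digraph.cycle (with_proj G) c \<and> 3 \<le> length c) \<and>
     (\<forall>v \<in> pverts G. card {w. (v, w) \<in> parcs G} = q + 1)"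

text \<open>Walks are lists of arcs, so the length of a path is its number of edges.\<close>

definition depth :: "'v pair_pre_digraph \<Rightarrow> 'v \<Rightarrow> 'v \<Rightarrow> nat" where
  "depth G r v = length (THE c. pre_digraph.apath (with_proj G) r c v)"

definition level :: "'v pair_pre_digraph \<Rightarrow> 'v \<Rightarrow> nat \<Rightarrow> 'v set" where
  "level G r n = {v \<in> pverts G. depth G r v = n}"

definition Mp ::
  "nat \<Rightarrow> 'v pair_pre_digraph \<Rightarrow> 'v \<Rightarrow> ereal \<Rightarrow> nat \<Rightarrow> ('v \<Rightarrow> complex) \<Rightarrow> real" where
  "Mp q G r p n f =
     (if n = 0 then cmod (f r)
      else if p = \<infinity> then Max ((\<lambda>v. cmod (f v)) ` level G r n)
      else (1 / ((real q + 1) * real q ^ (n - 1)) *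
              (\<Sum>v \<in> level G r n. cmod (f v) powr real_of_ereal p))
             powr (1 / real_of_ereal p))"

definition Tp_enorm ::
  "nat \<Rightarrow> 'v pair_pre_digraph \<Rightarrow> 'v \<Rightarrow> ereal \<Rightarrow> ('v \<Rightarrow> complex) \<Rightarrow> ereal" where
  "Tp_enorm q G r p f = (SUP n. ereal (Mp q G r p n f))"

text \<open>
  A function on the vertex set is represented by its extension by 0 to the whole type.
\<close>

definition Tp_space ::
  "nat \<Rightarrow> 'v pair_pre_digraph \<Rightarrow> 'v \<Rightarrow> ereal \<Rightarrow> ('v \<Rightarrow> complex) set" where
  "Tp_space q G r p = {f. (\<forall>v. v \<notin> pverts G \<longrightarrow> f v = 0) \<and> Tp_enorm q G r p f < \<infinity>}"

definition Tp_norm ::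
  "nat \<Rightarrow> 'v pair_pre_digraph \<Rightarrow> 'v \<Rightarrow> ereal \<Rightarrow> ('v \<Rightarrow> complex) \<Rightarrow> real" where
  "Tp_norm q G r p f = real_of_ereal (Tp_enorm q G r p f)"

definition complex_norm_on ::
  "(complex \<Rightarrow> 'a::ab_group_add \<Rightarrow> 'a) \<Rightarrow> 'a set \<Rightarrow> ('a \<Rightarrow> real) \<Rightarrow> bool" where
  "complex_norm_on smul S N \<longleftrightarrow>
     (\<forall>x\<in>S. 0 \<le> N x) \<and>
     (\<forall>x\<in>S. N x = 0 \<longleftrightarrow> x = 0) \<and>
     (\<forall>c. \<forall>x\<in>S. N (smul c x) = cmod c * N x) \<and>
     (\<forall>x\<in>S. \<forall>y\<in>S. N (x + y) \<le> N x + N y)"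

definition complex_banach_on ::
  "(complex \<Rightarrow> 'a::ab_group_add \<Rightarrow> 'a) \<Rightarrow> 'a set \<Rightarrow> ('a \<Rightarrow> real) \<Rightarrow> bool" where
  "complex_banach_on smul S N \<longleftrightarrow>
     vector_space smul \<and> module.subspace smul S \<and>
     complex_norm_on smul S N \<and>
     Metric_space S (\<lambda>x y. N (x - y)) \<and>
     Metric_space.mcomplete S (\<lambda>x y. N (x - y))"

end

theory Submission
  imports Defs
begin

text \<open>
  The norm is a supremum of seminorms, one per level, by Minkowski's inequality. Each seminorm is
  lower semicontinuous under pointwise convergence, and every point evaluation is bounded by
  one of them; so a Cauchy sequence converges pointwise, and the Cauchy estimates survive in the
  limit. From the tree one needs that each level is finite and nonempty and that the root is the
  only vertex of level 0, which rests on the uniqueness of paths.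
\<close>

section \<open>Minkowski's inequality for finite sums\<close>

text \<open>Convexity of the power function up to the endpoint 0. If \<open>a\<close> or
  \<open>b\<close> vanishes, the claim becomes \<open>(r * c) powr s \<le> r * c powr s\<close>,
  which follows from \<open>r powr s \<le> r\<close> for \<open>r\<close> in the unit
  interval.\<close>

lemma powr_convex_nonneg:
  fixes a b t s :: real
  assumes "0 \<le> a" "0 \<le> b" "0 \<le> t" "t \<le> 1" "1 \<le> s"
  shows "((1 - t) * a + t * b) powr s \<le> (1 - t) * a powr s + t * b powr s"
proof -
  have scaled: "(r * c) powr s \<le> r * c powr s" if "0 \<le> r" "r \<le> 1" "0 \<le> c" for r c :: real
  proof -
    have "r powr s \<le> r powr 1"
      using powr_mono'[of 1 s r] that assms by simp
    then show ?thesis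
      using that by (simp add: powr_mult mult_right_mono)
  qed
  consider "a = 0" | "b = 0" | "a > 0" "b > 0"
    using assms by linarith
  then show ?thesis
  proof cases
    case 1
    then show ?thesis using scaled[of t b] assms by simp
  next
    case 2
    then show ?thesis using scaled[of "1 - t" a] assms by simp
  next
    case 3
    then show ?thesis
      using convex_onD[OF powr_convex[OF \<open>1 \<le> s\<close>], of t a b] assms by simp
  qed
qed

text \<open>Normalise by the two norms \<open>X\<close> and \<open>Y\<close>:
  \<open>(x i + y i) / (X + Y)\<close> is a convex combination of \<open>x i / X\<close> and
  \<open>y i / Y\<close> whose weights do not depend on \<open>i\<close>. Convexity is applied
  termwise and then summed.\<close>

lemma Minkowski_sum:
  fixes x y :: "'a \<Rightarrow> real"
  assumes A: "finite A" and s: "1 \<le> s"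
    and x: "\<And>i. i \<in> A \<Longrightarrow> 0 \<le> x i" and y: "\<And>i. i \<in> A \<Longrightarrow> 0 \<le> y i"
  shows "(\<Sum>i\<in>A. (x i + y i) powr s) powr (1 / s)
    \<le> (\<Sum>i\<in>A. x i powr s) powr (1 / s) + (\<Sum>i\<in>A. y i powr s) powr (1 / s)"
proof -
  define X where "X = (\<Sum>i\<in>A. x i powr s) powr (1 / s)"
  define Y where "Y = (\<Sum>i\<in>A. y i powr s) powr (1 / s)"
  have Xs: "X powr s = (\<Sum>i\<in>A. x i powr s)" and Ys: "Y powr s = (\<Sum>i\<in>A. y i powr s)"
    using s by (simp_all add: X_def Y_def powr_powr sum_nonneg)
  have "X \<ge> 0" "Y \<ge> 0"
    by (simp_all add: X_def Y_def)
  then consider "X = 0" | "Y = 0" | "X > 0" "Y > 0"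
    by linarith
  then have "(\<Sum>i\<in>A. (x i + y i) powr s) powr (1 / s) \<le> X + Y"
  proof cases
    case 1
    then have "\<forall>i\<in>A. x i = 0"
      using Xs A s by (simp add: sum_nonneg_eq_0_iff)
    then show ?thesis by (simp add: 1 Y_def)
  next
    case 2
    then have "\<forall>i\<in>A. y i = 0"
      using Ys A s by (simp add: sum_nonneg_eq_0_iff)
    then show ?thesis by (simp add: 2 X_def)
  next
    case 3
    define t where "t = Y / (X + Y)"
    have t: "0 \<le> t" "t \<le> 1" "(X + Y) * t = Y" "(X + Y) * (1 - t) = X"
      using 3 by (simp_all add: t_def field_simps)
    have "(x i + y i) powr s
        \<le> (X + Y) powr s * ((1 - t) * (x i powr s / X powr s) + t * (y i powr s / Y powr s))"
      if "i \<in> A" for i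
    proof -
      have "x i + y i = ((X + Y) * (1 - t)) * (x i / X) + ((X + Y) * t) * (y i / Y)"
        unfolding t using 3 by simp
      also have "\<dots> = (X + Y) * ((1 - t) * (x i / X) + t * (y i / Y))"
        by (simp only: distrib_left mult.assoc)
      finally have "(x i + y i) powr s
          = (X + Y) powr s * ((1 - t) * (x i / X) + t * (y i / Y)) powr s"
        using 3 t x[OF that] y[OF that] by (simp add: powr_mult)
      moreover have "((1 - t) * (x i / X) + t * (y i / Y)) powr s
          \<le> (1 - t) * (x i / X) powr s + t * (y i / Y) powr s"
        using 3 t s x[OF that] y[OF that] by (intro powr_convex_nonneg) auto
      ultimately show ?thesis
        using 3 x[OF that] y[OF that] by (simp add: powr_divide mult_left_mono)
    qed
    then have "(\<Sum>i\<in>A. (x i + y i) powr s) \<le> (\<Sum>i\<in>A. (X + Y) powr s *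
        ((1 - t) * (x i powr s / X powr s) + t * (y i powr s / Y powr s)))"
      by (rule sum_mono)
    also have "\<dots> = (X + Y) powr s * ((1 - t) * ((\<Sum>i\<in>A. x i powr s) / X powr s)
        + t * ((\<Sum>i\<in>A. y i powr s) / Y powr s))"
      by (simp add: sum_distrib_left sum_divide_distrib sum.distrib distrib_left)
    \<comment> \<open>Both normalised sums equal 1, so only the weights \<open>1 - t\<close> and
      \<open>t\<close> remain, and they add up to 1.\<close>
    also have "\<dots> = (X + Y) powr s"
      unfolding Xs[symmetric] Ys[symmetric] using 3 by simp
    finally have "(\<Sum>i\<in>A. (x i + y i) powr s) powr (1 / s) \<le> ((X + Y) powr s) powr (1 / s)"
      using s by (intro powr_mono2) (auto intro: sum_nonneg)
    then show ?thesis
      using 3 s by (simp add: powr_powr)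
  qed
  then show ?thesis by (simp add: X_def Y_def)
qed

section \<open>Suprema of seminorms\<close>

text \<open>Everything about the tree is hidden in the family \<open>M\<close>. Assumption
  \<open>point\<close> gives definiteness and turns norm-Cauchy into pointwise Cauchy;
  \<open>lsc\<close> carries bounds over to the pointwise limit.\<close>

lemma complex_banach_on_SUP_seminorms:
  fixes M :: "'i \<Rightarrow> ('v \<Rightarrow> complex) \<Rightarrow> real" and V :: "'v set"
  defines "E \<equiv> \<lambda>f. SUP n. ereal (M n f)"
  assumes nonneg: "\<And>n f. 0 \<le> M n f"
    and scale: "\<And>n c f. M n (\<lambda>v. c * f v) = cmod c * M n f"
    and triangle: "\<And>n f g. M n (f + g) \<le> M n f + M n g"
    and point: "\<And>v. v \<in> V \<Longrightarrow> \<exists>n C. \<forall>f. cmod (f v) \<le> C * M n f"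
    and lsc: "\<And>n F f e. (\<And>v. (\<lambda>k. F k v) \<longlonglongrightarrow> f v) \<Longrightarrow> (\<And>k. M n (F k) \<le> e) \<Longrightarrow> M n f \<le> e"
  shows "complex_banach_on (\<lambda>c f v. c * f v)
    {f. (\<forall>v. v \<notin> V \<longrightarrow> f v = 0) \<and> E f < \<infinity>} (\<lambda>f. real_of_ereal (E f))"
proof -
  define S where "S = {f. (\<forall>v. v \<notin> V \<longrightarrow> f v = 0) \<and> E f < \<infinity>}"
  define N where "N = (\<lambda>f. real_of_ereal (E f))"
  have M_E: "ereal (M n f) \<le> E f" for n f
    unfolding E_def by (rule SUP_upper) simp
  have E_nonneg: "0 \<le> E f" for f
    using M_E[of undefined f] nonneg[of undefined f] by (meson ereal_less_eq(5) order_trans)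
  have N_nonneg: "0 \<le> N f" for f
    unfolding N_def using E_nonneg by (simp add: real_of_ereal_pos)
  have E_N: "E f = ereal (N f)" if "f \<in> S" for f
    \<comment> \<open>Since \<open>real_of_ereal\<close> sends infinity to 0, \<open>N\<close>
      reflects \<open>E\<close> only where \<open>E\<close> is finite, which membership in
      \<open>S\<close> ensures.\<close>
    using that E_nonneg[of f] unfolding S_def N_def by (cases "E f") auto
  have M_N: "M n f \<le> N f" if "f \<in> S" for f n
    using M_E[of n f] E_N[OF that] by simp
  have E_le: "E f \<le> ereal e" if "\<And>n. M n f \<le> e" for f e
    unfolding E_def using that by (auto intro: SUP_least)
  \<comment> \<open>The uniform bound itself makes \<open>E f\<close> finite.\<close>
  have N_le: "N f \<le> e" if "\<And>n. M n f \<le> e" for f e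
    using E_le[OF that] E_nonneg[of f] unfolding N_def by (cases "E f") auto
  have S_I: "f \<in> S" if "\<And>v. v \<notin> V \<Longrightarrow> f v = 0" "\<And>n. M n f \<le> e" for f e
    using E_le[of f e, OF that(2)] that(1) unfolding S_def
    by (auto intro: le_less_trans)
  have S_D: "f v = 0" if "f \<in> S" "v \<notin> V" for f v
    using that unfolding S_def by auto
  have M_0: "M n 0 = 0" for n
    using scale[of n 0 0] by (simp add: zero_fun_def)
  have zero_S: "0 \<in> S"
    by (rule S_I[of _ 0]) (auto simp: M_0)
  have add_S: "f + g \<in> S" and add_N: "N (f + g) \<le> N f + N g" if "f \<in> S" "g \<in> S" for f g
  proof -
    have le: "M n (f + g) \<le> N f + N g" for n
      using triangle[of n f g] M_N[OF that(1), of n] M_N[OF that(2), of n] by linarith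
    show "f + g \<in> S" by (rule S_I[OF _ le]) (auto simp: S_D that)
    show "N (f + g) \<le> N f + N g" by (rule N_le[OF le])
  qed
  have scale_S: "(\<lambda>v. c * f v) \<in> S" and scale_le: "N (\<lambda>v. c * f v) \<le> cmod c * N f"
    if "f \<in> S" for c f
  proof -
    have le: "M n (\<lambda>v. c * f v) \<le> cmod c * N f" for n
      unfolding scale by (intro mult_left_mono M_N that) simp
    show "(\<lambda>v. c * f v) \<in> S" by (rule S_I[OF _ le]) (auto simp: S_D that)
    show "N (\<lambda>v. c * f v) \<le> cmod c * N f" by (rule N_le[OF le])
  qed
  have N_0: "N 0 = 0"
    using N_le[of 0 0] N_nonneg[of 0] by (simp add: M_0)
  have scale_N: "N (\<lambda>v. c * f v) = cmod c * N f" if "f \<in> S" for c f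
  proof (cases "c = 0")
    case True
    then show ?thesis using N_0 by (simp add: zero_fun_def)
  next
    case False
    \<comment> \<open>The reverse inequality is \<open>scale_le\<close> applied to the function
      \<open>c * f\<close> and the scalar \<open>inverse c\<close>.\<close>
    have "cmod c * N f \<le> N (\<lambda>v. c * f v)"
      using scale_le[OF scale_S[OF that, of c], of "inverse c"] False
      by (simp add: mult.assoc[symmetric] norm_divide field_simps)
    then show ?thesis using scale_le[OF that, of c] by simp
  qed
  have pointN: "\<exists>C\<ge>0. \<forall>f\<in>S. cmod (f v) \<le> C * N f" for v
  proof (cases "v \<in> V")
    case True
    then obtain n C where C: "\<And>f. cmod (f v) \<le> C * M n f" using point by blast
    have "cmod (f v) \<le> \<bar>C\<bar> * N f" if "f \<in> S" for f
    proof -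
      have "C * M n f \<le> \<bar>C\<bar> * M n f" by (intro mult_right_mono nonneg) simp
      also have "\<dots> \<le> \<bar>C\<bar> * N f" by (intro mult_left_mono M_N that) simp
      finally show ?thesis using C[of f] by simp
    qed
    then show ?thesis by (intro exI[of _ "\<bar>C\<bar>"]) auto
  next
    case False
    then show ?thesis by (intro exI[of _ 0]) (auto simp: S_D)
  qed
  have N_eq_0: "N f = 0 \<longleftrightarrow> f = 0" if "f \<in> S" for f
  proof
    assume "N f = 0"
    then have "f v = 0" for v using pointN[of v] that by force
    then show "f = 0" by auto
  qed (simp add: N_0)
  have uminus: "- f = (\<lambda>v. (-1) * f v)" for f :: "'v \<Rightarrow> complex" by auto
  have minus_S: "- f \<in> S" and minus_N: "N (- f) = N f" if "f \<in> S" for f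
    unfolding uminus using scale_S[OF that, of "-1"] scale_N[OF that, of "-1"] by simp_all
  have diff_S: "f - g \<in> S" if "f \<in> S" "g \<in> S" for f g
    using add_S[OF that(1) minus_S[OF that(2)]] by simp
  have vs: "vector_space (\<lambda>c (f :: 'v \<Rightarrow> complex) v. c * f v)"
    by unfold_locales (auto simp: algebra_simps)
  then interpret vector_space "\<lambda>c (f :: 'v \<Rightarrow> complex) v. c * f v" .
  have sub: "subspace S"
    unfolding subspace_def using zero_S add_S scale_S by blast
  have norm: "complex_norm_on (\<lambda>c f v. c * f v) S N"
    unfolding complex_norm_on_def using N_nonneg N_eq_0 scale_N add_N by blast
  have metric: "Metric_space S (\<lambda>f g. N (f - g))"
  proof
    fix f g h
    show "0 \<le> N (f - g)" by (rule N_nonneg)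
    \<comment> \<open>\<open>Metric_space\<close> asks for symmetry for arbitrary functions, not
      just members of \<open>S\<close>, so it is proved for each seminorm instead of for
      \<open>N\<close> on \<open>S\<close>.\<close>
    have "M n (f - g) = M n (g - f)" for n
      using scale[of n "-1" "f - g"] by (simp add: fun_diff_def)
    then show "N (f - g) = N (g - f)" by (simp add: N_def E_def)
    assume fg: "f \<in> S" "g \<in> S"
    show "N (f - g) = 0 \<longleftrightarrow> f = g" using N_eq_0[OF diff_S[OF fg]] by simp
    assume h: "h \<in> S"
    show "N (f - h) \<le> N (f - g) + N (g - h)"
      using add_N[OF diff_S[OF fg] diff_S[OF fg(2) h]] by simp
  qed
  then interpret Metric_space S "\<lambda>f g. N (f - g)" .
  have "mcomplete"
    unfolding mcomplete_def
  proof (intro allI impI)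
    fix F assume "MCauchy F"
    then have FS: "\<And>k. F k \<in> S"
      and cau: "\<And>e. e > 0 \<Longrightarrow> \<exists>K. \<forall>k k'. K \<le> k \<longrightarrow> K \<le> k' \<longrightarrow> N (F k - F k') < e"
      unfolding MCauchy_def by auto
    have "Cauchy (\<lambda>k. F k v)" for v
    proof (rule metric_CauchyI)
      fix e :: real assume "e > 0"
      from pointN obtain C where C: "C \<ge> 0" "\<And>f. f \<in> S \<Longrightarrow> cmod (f v) \<le> C * N f" by blast
      \<comment> \<open>Dividing by \<open>C + 1\<close> allows \<open>C = 0\<close> and makes the
        final estimate strict.\<close>
      obtain K where K: "\<And>k k'. K \<le> k \<Longrightarrow> K \<le> k' \<Longrightarrow> N (F k - F k') < e / (C + 1)"
        using cau[of "e / (C + 1)"] \<open>e > 0\<close> C by auto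
      have "dist (F k v) (F k' v) < e" if "K \<le> k" "K \<le> k'" for k k'
      proof -
        have "dist (F k v) (F k' v) \<le> C * N (F k - F k')"
          using C(2)[OF diff_S[OF FS[of k] FS[of k']]] by (simp add: dist_norm)
        also have "\<dots> \<le> C * (e / (C + 1))"
          using K[OF that] C by (intro mult_left_mono) auto
        also have "\<dots> < e" using C \<open>e > 0\<close> by (simp add: field_simps)
        finally show ?thesis .
      qed
      then show "\<exists>K. \<forall>k\<ge>K. \<forall>k'\<ge>K. dist (F k v) (F k' v) < e" by blast
    qed
    then have "\<forall>v. \<exists>l. (\<lambda>k. F k v) \<longlonglongrightarrow> l"
      using Cauchy_convergent_iff convergent_def by blast
    then obtain f where f: "\<And>v. (\<lambda>k. F k v) \<longlonglongrightarrow> f v" by metis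
    have f0: "f v = 0" if "v \<notin> V" for v
      using f[of v] S_D[OF FS that] by (simp add: LIMSEQ_const_iff)
    \<comment> \<open>Keep \<open>k\<close> fixed and let the other index tend to infinity. The
      shift by \<open>K\<close> makes every term of the sequence satisfy the Cauchy bound, as
      \<open>lsc\<close> requires.\<close>
    have close: "M n (F k - f) \<le> e"
      if "\<And>k'. K \<le> k' \<Longrightarrow> N (F k - F k') < e" for n k K e
    proof (rule lsc[where F = "\<lambda>j. F k - F (j + K)"])
      show "(\<lambda>j. (F k - F (j + K)) v) \<longlonglongrightarrow> (F k - f) v" for v
        using LIMSEQ_ignore_initial_segment[OF f[of v], of K] by (auto intro: tendsto_intros)
      show "M n (F k - F (j + K)) \<le> e" for j
        using M_N[OF diff_S[OF FS FS], of n k "j + K"] that[of "j + K"] by simp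
    qed
    obtain K1 where "\<And>k'. K1 \<le> k' \<Longrightarrow> N (F K1 - F k') < 1"
      using cau[of 1] by auto
    \<comment> \<open>The limit lies in \<open>S\<close> because it differs from the member
      \<open>F K1\<close> by a function whose seminorms are at most 1.\<close>
    then have "F K1 - f \<in> S"
      by (intro S_I[of _ 1] close) (auto simp: f0 S_D[OF FS])
    then have "F K1 - (F K1 - f) \<in> S" by (rule diff_S[OF FS])
    then have fS: "f \<in> S" by simp
    have "\<exists>K. \<forall>k\<ge>K. F k \<in> S \<and> N (F k - f) < e" if "e > 0" for e
    proof -
      \<comment> \<open>Half of \<open>e\<close>, because passing to the limit leaves only a weak
        inequality.\<close>
      obtain K where K: "\<And>k k'. K \<le> k \<Longrightarrow> K \<le> k' \<Longrightarrow> N (F k - F k') < e / 2"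
        using cau[of "e / 2"] \<open>e > 0\<close> by auto
      have "N (F k - f) \<le> e / 2" if "K \<le> k" for k
        by (intro N_le close[of K] K that)
      then show ?thesis
        using \<open>e > 0\<close> FS by (intro exI[of _ K]) force
    qed
    then show "\<exists>f. limitin mtopology F f sequentially"
      unfolding limitin_metric eventually_sequentially using fS by blast
  qed
  then show ?thesis
    using vs sub norm metric unfolding complex_banach_on_def S_def N_def by blast
qed

section \<open>Levels of a homogeneous tree\<close>

context pair_bidirected_digraph
begin

text \<open>Induction on the first path with a varying start. Equal first arcs leave two shorter
  paths to compare; different first arcs would produce a cycle.\<close>

lemma apath_unique:
  assumes acyclic: "\<not> (\<exists>c. cycle c \<and> 3 \<le> length c)"
    and "apath u p v" "apath u q v"
  shows "p = q"
  using assms(2,3)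
proof (induction p arbitrary: u q)
  case Nil
  then show ?case by (metis apath_Nil_iff apath_nonempty_ends)
next
  case (Cons e p)
  then have "u \<noteq> v" using apath_nonempty_ends by blast
  with Cons.prems(2) obtain f q' where q: "q = f # q'"
    by (cases q) (auto simp: apath_Nil_iff)
  obtain a where e: "e = (u, a)" "(u, a) \<in> parcs G" "apath a p v" "u \<notin> set (pawalk_verts a p)"
    using Cons.prems(1) by (cases e) (auto simp: apath_Cons_iff)
  obtain b where f: "f = (u, b)" "(u, b) \<in> parcs G" "apath b q' v" "u \<notin> set (pawalk_verts b q')"
    using Cons.prems(2) by (cases f) (auto simp: apath_Cons_iff q)
  show ?case
  proof (cases "a = b")
    case True
    then show ?thesis using Cons.IH[OF e(3)] e f q by auto
  next
    case False
    text \<open>Following the first path backwards and the second one forwards leads from \<open>a\<close> to \<open>b\<close>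
      without meeting \<open>u\<close>, and \<open>u\<close> closes this up to a cycle.\<close>
    have pq: "awalk b q' v" "awalk a p v"
      using e f by (auto intro: awalkI_apath)
    define w where "w = p @ rev_path q'"
    have w: "awalk a w b" unfolding w_def using pq by (intro awalk_appendI) auto
    \<comment> \<open>Stated for the ends of arcs, since the path extracted from \<open>w\<close>
      below is known only to use arcs of \<open>w\<close>.\<close>
    have uw: "u \<notin> fst ` set w \<and> u \<notin> snd ` set w"
    proof -
      have "set (pawalk_verts a w) = set (pawalk_verts a p) \<union> set (pawalk_verts v (rev_path q'))"
        unfolding w_def using pq by (intro set_awalk_verts_append) auto
      also have "pawalk_verts v (rev_path q') = rev (pawalk_verts b q')"
        using pq by (intro awalk_verts_rev_path)
      finally have "u \<notin> set (pawalk_verts a w)" using e f by simp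
      then show ?thesis using set_awalk_verts[OF w] by auto
    qed
    \<comment> \<open>The two branches may share vertices, so \<open>w\<close> need not be a path;
      it is shortened to one.\<close>
    define s where "s = awalk_to_apath w"
    have s: "apath a s b" "set s \<subseteq> set w"
      unfolding s_def using w by (auto intro: apath_awalk_to_apath dest: awalk_to_apath_subset)
    then have aws: "awalk a s b" by (auto intro: awalkI_apath)
    have "u \<noteq> a" using e pair_no_loops by fastforce
    have us: "u \<notin> set (pawalk_verts a s)"
      using set_awalk_verts[OF aws] uw s(2) \<open>u \<noteq> a\<close> by auto
    \<comment> \<open>This separates the cycle from a mere edge traversed back and forth: with the
      two arcs at \<open>u\<close> its length is at least 3.\<close>
    have "s \<noteq> []" using False aws by (auto simp: awalk_Nil_iff)
    have bu: "(b, u) \<in> parcs G" using f arcs_symmetric by blast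
    have cyc: "awalk a (s @ [(b, u)]) u"
      using aws bu by (intro awalk_appendI[OF aws]) (auto simp: awalk_simps wellformed')
    have "pawalk_verts a (s @ [(b, u)]) = pawalk_verts a s @ [u]"
      using awalk_verts_append[OF cyc] aws by auto
    then have "cycle ((u, a) # s @ [(b, u)])"
      unfolding cycle_def using cyc e us s(1)
      by (intro exI[of _ u]) (auto simp: awalk_Cons_iff apath_def)
    moreover have "3 \<le> length ((u, a) # s @ [(b, u)])"
      using \<open>s \<noteq> []\<close> by (cases s) auto
    ultimately show ?thesis using acyclic by blast
  qed
qed

lemma depth_eq:
  assumes "\<not> (\<exists>c. cycle c \<and> 3 \<le> length c)" "apath u p v"
  shows "depth G u v = length p"
proof -
  have "(THE c. apath u c v) = p"
    using assms apath_unique by (intro the_equality) blast+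
  then show ?thesis by (simp add: depth_def)
qed

end

locale homogeneous_tree_rooted =
  fixes q :: nat and G :: "'v pair_pre_digraph" and r :: 'v
  assumes tree: "homogeneous_tree q G"
    and root: "r \<in> pverts G"

sublocale homogeneous_tree_rooted \<subseteq> pair_bidirected_digraph G
  using tree by (simp add: homogeneous_tree_def)

context homogeneous_tree_rooted
begin

lemma acyclic: "\<not> (\<exists>c. cycle c \<and> 3 \<le> length c)"
  using tree by (simp add: homogeneous_tree_def)

text \<open>Symmetry of the arcs upgrades connectedness to strong connectedness, and reachability
  yields a path.\<close>

lemma ex_apath:
  assumes "v \<in> pverts G"
  shows "\<exists>p. apath r p v"
proof -
  have "strongly_connected G"
    using tree symmetric_connected_imp_strongly_connected pair_sym_arcs
    by (simp add: homogeneous_tree_def)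
  then have "r \<rightarrow>\<^sup>*\<^bsub>with_proj G\<^esub> v"
    using assms root by (auto simp: strongly_connected_def)
  then show ?thesis by (simp add: reachable_apath)
qed

lemma mem_level_iff: "v \<in> level G r n \<longleftrightarrow> (\<exists>p. apath r p v \<and> length p = n)"
proof -
  have "v \<in> pverts G" if "apath r p v" for p
    using awalkI_apath[OF that] by auto
  then show ?thesis
    using ex_apath depth_eq[OF acyclic] by (fastforce simp: level_def)
qed

lemma level_0: "level G r 0 = {r}"
  using root by (auto simp: mem_level_iff apath_Nil_iff)

text \<open>Removing the last arc of the path to \<open>v\<close> leaves a path from the root that
  is shorter by one.\<close>

lemma level_Suc_predecessor:
  assumes "v \<in> level G r (Suc n)"
  shows "\<exists>u \<in> level G r n. (u, v) \<in> parcs G"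
proof -
  obtain p where p: "apath r p v" "length p = Suc n"
    using assms by (auto simp: mem_level_iff)
  then obtain p' e where pe: "p = p' @ [e]" by (cases p rule: rev_cases) auto
  then have "apath r p' (awlast r p')" "apath (awlast r p') [e] v"
    using p(1) by (simp_all add: apath_append_iff)
  moreover from this(2) have "e = (awlast r p', v)" "e \<in> parcs G"
    by (cases e; simp add: apath_Cons_iff apath_Nil_iff)+
  ultimately show ?thesis
    using p(2) pe by (intro bexI[of _ "awlast r p'"]) (auto simp: mem_level_iff)
qed

lemma finite_level: "finite (level G r n)"
proof (induction n)
  case (Suc n)
  have "level G r (Suc n) \<subseteq> (\<Union>u \<in> level G r n. {w. (u, w) \<in> parcs G})"
    using level_Suc_predecessor by blast
  moreover have "finite {w. (u, w) \<in> parcs G}" if "u \<in> level G r n" for u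
  proof -
    have "card {w. (u, w) \<in> parcs G} = q + 1"
      using tree that by (simp add: homogeneous_tree_def level_def)
    \<comment> \<open>An infinite set has \<open>card\<close> 0, so the positive cardinality
      \<open>q + 1\<close> includes finiteness.\<close>
    then show ?thesis by (intro card_ge_0_finite) simp
  qed
  ultimately show ?case
    using Suc by (meson finite_UN_I finite_subset)
qed (simp add: level_0)

text \<open>By the predecessor property an empty level empties all later ones, and then finitely
  many finite levels would exhaust the vertices.\<close>

lemma level_nonempty:
  assumes "infinite (pverts G)"
  shows "level G r n \<noteq> {}"
proof
  assume n: "level G r n = {}"
  have empty: "level G r m = {}" if "n \<le> m" for m
    using that n by (induction m rule: dec_induct) (use level_Suc_predecessor in blast)+
  have "pverts G \<subseteq> (\<Union>m<n. level G r m)"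
  proof
    fix v assume "v \<in> pverts G"
    then have "v \<in> level G r (depth G r v)" by (simp add: level_def)
    then show "v \<in> (\<Union>m<n. level G r m)" using empty not_le by blast
  qed
  then show False
    using assms finite_level by (meson finite_UN_I finite_lessThan finite_subset)
qed

end

section \<open>The means on the levels\<close>

lemma powr_mean_scale:
  fixes a s c :: real
  assumes "0 < s" "0 \<le> a" "0 \<le> c" "\<And>v. v \<in> L \<Longrightarrow> 0 \<le> x v"
  shows "(a * (\<Sum>v\<in>L. (c * x v) powr s)) powr (1 / s) = c * (a * (\<Sum>v\<in>L. x v powr s)) powr (1 / s)"
proof -
  have "(\<Sum>v\<in>L. (c * x v) powr s) = c powr s * (\<Sum>v\<in>L. x v powr s)"
    using assms by (simp add: powr_mult sum_distrib_left)
  then have "(a * (\<Sum>v\<in>L. (c * x v) powr s)) powr (1 / s)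
      = (c powr s * (a * (\<Sum>v\<in>L. x v powr s))) powr (1 / s)"
    by (simp add: mult.left_commute)
  also have "\<dots> = c * (a * (\<Sum>v\<in>L. x v powr s)) powr (1 / s)"
    using assms by (simp add: powr_mult powr_powr sum_nonneg)
  finally show ?thesis .
qed

context homogeneous_tree_rooted
begin

context
  assumes q: "1 \<le> q" and inf: "infinite (pverts G)"
begin

lemma Mp_infinity_le_iff:
  assumes "n \<noteq> 0"
  shows "Mp q G r \<infinity> n f \<le> e \<longleftrightarrow> (\<forall>v \<in> level G r n. cmod (f v) \<le> e)"
  using assms finite_level level_nonempty[OF inf] by (simp add: Mp_def)

lemma norm_le_Mp_infinity:
  assumes "n \<noteq> 0" "v \<in> level G r n"
  shows "cmod (f v) \<le> Mp q G r \<infinity> n f"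
  using Mp_infinity_le_iff assms by blast

text \<open>Only \<open>Max\<close> calls for an argument: it dominates the modulus at some vertex
  because the level is nonempty.\<close>

lemma Mp_nonneg: "0 \<le> Mp q G r p n f"
proof -
  obtain v where "v \<in> level G r n" using level_nonempty[OF inf] by blast
  then have "0 \<le> Mp q G r \<infinity> n f" if "n \<noteq> 0"
    using norm_le_Mp_infinity[OF that] norm_ge_zero order_trans by blast
  then show ?thesis by (auto simp: Mp_def)
qed

lemma Mp_scale:
  assumes "1 \<le> p"
  shows "Mp q G r p n (\<lambda>v. c * f v) = cmod c * Mp q G r p n f"
proof -
  consider "n = 0" | "n \<noteq> 0" "p = \<infinity>" | s where "n \<noteq> 0" "p = ereal s" "1 \<le> s"
    using assms by (cases p) auto
  then show ?thesis
  proof cases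
    case 1
    then show ?thesis by (simp add: Mp_def norm_mult)
  next
    case 2
    \<comment> \<open>Multiplication by a nonnegative constant is monotone and so commutes with
      \<open>Max\<close>.\<close>
    have "cmod c * Max ((\<lambda>v. cmod (f v)) ` level G r n)
        = Max ((\<lambda>x. cmod c * x) ` (\<lambda>v. cmod (f v)) ` level G r n)"
      using finite_level level_nonempty[OF inf]
      by (intro mono_Max_commute) (auto intro!: monoI mult_left_mono)
    then show ?thesis
      using 2 by (simp add: Mp_def norm_mult image_image)
  next
    case 3
    then show ?thesis
      unfolding Mp_def by (simp add: norm_mult powr_mean_scale del: times_divide_eq_left)
  qed
qed

lemma Mp_triangle:
  assumes "1 \<le> p"
  shows "Mp q G r p n (f + g) \<le> Mp q G r p n f + Mp q G r p n g"
proof -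
  consider "n = 0" | "n \<noteq> 0" "p = \<infinity>" | s where "n \<noteq> 0" "p = ereal s" "1 \<le> s"
    using assms by (cases p) auto
  then show ?thesis
  proof cases
    case 1
    then show ?thesis by (simp add: Mp_def norm_triangle_ineq)
  next
    case 2
    have "cmod ((f + g) v) \<le> Mp q G r \<infinity> n f + Mp q G r \<infinity> n g" if "v \<in> level G r n" for v
      using norm_triangle_ineq[of "f v" "g v"] norm_le_Mp_infinity[OF 2(1) that, of f]
        norm_le_Mp_infinity[OF 2(1) that, of g]
      by simp
    then show ?thesis using Mp_infinity_le_iff 2 by blast
  next
    case 3
    define a where "a = 1 / ((real q + 1) * real q ^ (n - 1))"
    have "a \<ge> 0" by (simp add: a_def)
    \<comment> \<open>The normalising weight is pulled out so that the unweighted Minkowski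
      inequality applies.\<close>
    have Mp_eq: "Mp q G r p n h = a powr (1 / s) * (\<Sum>v\<in>level G r n. cmod (h v) powr s) powr (1 / s)"
      for h
    proof -
      have "Mp q G r p n h = (a * (\<Sum>v\<in>level G r n. cmod (h v) powr s)) powr (1 / s)"
        using 3 by (simp add: Mp_def a_def)
      then show ?thesis
        using \<open>a \<ge> 0\<close> by (simp add: powr_mult sum_nonneg)
    qed
    have "(\<Sum>v\<in>level G r n. cmod ((f + g) v) powr s) powr (1 / s)
        \<le> (\<Sum>v\<in>level G r n. (cmod (f v) + cmod (g v)) powr s) powr (1 / s)"
      using 3 by (intro powr_mono2 sum_mono) (auto intro: sum_nonneg norm_triangle_ineq)
    also have "\<dots> \<le> (\<Sum>v\<in>level G r n. cmod (f v) powr s) powr (1 / s)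
        + (\<Sum>v\<in>level G r n. cmod (g v) powr s) powr (1 / s)"
      using 3 by (intro Minkowski_sum finite_level) auto
    finally show ?thesis
      unfolding Mp_eq distrib_left[symmetric] by (intro mult_left_mono) auto
  qed
qed

text \<open>The level of \<open>v\<close> itself serves: one summand is at most the whole sum, and
  undoing the normalisation costs a factor independent of \<open>f\<close>.\<close>

lemma norm_le_Mp:
  assumes "1 \<le> p" "v \<in> pverts G"
  shows "\<exists>n C. \<forall>f. cmod (f v) \<le> C * Mp q G r p n f"
proof -
  define n where "n = depth G r v"
  have v: "v \<in> level G r n" using assms by (simp add: n_def level_def)
  consider "n = 0" | "n \<noteq> 0" "p = \<infinity>" | s where "n \<noteq> 0" "p = ereal s" "1 \<le> s"
    using assms by (cases p) auto
  then show ?thesis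
  proof cases
    case 1
    then show ?thesis
      using v by (intro exI[of _ 0] exI[of _ 1]) (simp add: Mp_def level_0)
  next
    case 2
    then show ?thesis
      using norm_le_Mp_infinity[OF _ v] by (intro exI[of _ n] exI[of _ 1]) simp
  next
    case 3
    \<comment> \<open>The reciprocal of the normalising weight; it is positive because
      \<open>q\<close> is.\<close>
    define K where "K = (real q + 1) * real q ^ (n - 1)"
    have "K > 0" using q by (simp add: K_def)
    have "cmod (f v) \<le> K powr (1 / s) * Mp q G r p n f" for f
    proof -
      have "cmod (f v) = (cmod (f v) powr s) powr (1 / s)"
        using 3 by (simp add: powr_powr)
      also have "\<dots> \<le> (\<Sum>v\<in>level G r n. cmod (f v) powr s) powr (1 / s)"
        using 3 by (intro powr_mono2 member_le_sum[OF v] finite_level) auto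
      also have "\<dots> = (K * (1 / K * (\<Sum>v\<in>level G r n. cmod (f v) powr s))) powr (1 / s)"
        using \<open>K > 0\<close> by simp
      also have "\<dots> = K powr (1 / s) * (1 / K * (\<Sum>v\<in>level G r n. cmod (f v) powr s)) powr (1 / s)"
        by (rule powr_mult)
      also have "(1 / K * (\<Sum>v\<in>level G r n. cmod (f v) powr s)) powr (1 / s) = Mp q G r p n f"
        using 3 by (simp add: Mp_def K_def)
      finally show ?thesis .
    qed
    then show ?thesis by blast
  qed
qed

text \<open>A level is finite, so for finite \<open>p\<close> the mean depends continuously on
  finitely many values. For \<open>p = \<infinity>\<close> the bound passes to the limit at each
  vertex.\<close>

lemma Mp_le_of_tendsto:
  assumes "1 \<le> p" and lim: "\<And>v. (\<lambda>k. F k v) \<longlonglongrightarrow> f v"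
    and le: "\<And>k. Mp q G r p n (F k) \<le> e"
  shows "Mp q G r p n f \<le> e"
proof -
  consider "n = 0" | "n \<noteq> 0" "p = \<infinity>" | s where "n \<noteq> 0" "p = ereal s" "1 \<le> s"
    using assms by (cases p) auto
  then show ?thesis
  proof cases
    case 1
    then show ?thesis
      using le LIMSEQ_le_const2[OF tendsto_norm[OF lim[of r]]] by (auto simp: Mp_def)
  next
    case 2
    have "cmod (f v) \<le> e" if "v \<in> level G r n" for v
      using le that 2 LIMSEQ_le_const2[OF tendsto_norm[OF lim[of v]]]
      by (auto simp: Mp_infinity_le_iff)
    then show ?thesis using 2 by (simp add: Mp_infinity_le_iff)
  next
    case 3
    \<comment> \<open>The bases of the powers may tend to 0; \<open>tendsto_powr'\<close> covers
      this because the exponents are positive and the bases nonnegative.\<close>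
    have "(\<lambda>k. Mp q G r p n (F k)) \<longlonglongrightarrow> Mp q G r p n f"
      unfolding Mp_def using 3 q
      by (auto intro!: tendsto_powr' tendsto_divide tendsto_const tendsto_sum tendsto_norm lim
          always_eventually sum_nonneg divide_nonneg_nonneg)
    then show ?thesis using le by (auto intro: LIMSEQ_le_const2)
  qed
qed

end

end

theorem theorem1:
  fixes G :: "'v pair_pre_digraph" and r :: 'v and q :: nat and p :: ereal
  assumes "1 \<le> q"
    and "homogeneous_tree q G"
    and "infinite (pverts G)"
    and "r \<in> pverts G"
    and "1 \<le> p"
  shows "complex_banach_on (\<lambda>c f v. c * f v) (Tp_space q G r p) (Tp_norm q G r p)"
proof -
  interpret homogeneous_tree_rooted q G r
    using assms by unfold_locales
  note q_inf = \<open>1 \<le> q\<close> \<open>infinite (pverts G)\<close>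
  have "complex_banach_on (\<lambda>c f v. c * f v)
    {f. (\<forall>v. v \<notin> pverts G \<longrightarrow> f v = 0) \<and> (SUP n. ereal (Mp q G r p n f)) < \<infinity>}
    (\<lambda>f. real_of_ereal (SUP n. ereal (Mp q G r p n f)))"
    by (rule complex_banach_on_SUP_seminorms[OF Mp_nonneg[OF q_inf] Mp_scale[OF q_inf \<open>1 \<le> p\<close>]
          Mp_triangle[OF q_inf \<open>1 \<le> p\<close>] norm_le_Mp[OF q_inf \<open>1 \<le> p\<close>]
          Mp_le_of_tendsto[OF q_inf \<open>1 \<le> p\<close>]])
  then show ?thesis
    by (simp add: Tp_space_def Tp_norm_def[abs_def] Tp_enorm_def)
qed

end
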